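(* Consider the zero-temperature Glauber dynamics $(\sigma(t))_{t\ge 0}$ on the slab $S_k=\mathbb{Z}^2\times\{0,\dots,k-1\}$ started from i.i.d. symmetric spins ($p=1/2$). For every $k\ge 4$, with periodic boundary conditions in the third coordinate, $S_k$ does not fixate. For every $k\ge 3$, with free boundary conditions, $S_k$ does not fixate.
   Context: For $k\ge 2$, the slab $S_k$ is the graph with vertex set $\mathbb{Z}^2\times\{0,1,\dots,k-1\}$. With free boundary conditions its edge set is $\mathcal{E}_k=\{\{x,y\}: \|x-y\|_1=1\}$. With periodic boundary conditions, in addition $(x,y,k-1)$ and $(x,y,0)$ are joined by an edge for every $(x,y)\in\mathbb{Z}^2$. The initial configuration $\sigma(0)=(\sigma_x(0))_{x\in S_k}\in\Omega_k=\{-1,1\}^{S_k}$ has i.i.d. coordinates with $\sigma_x(0)=+1$ with probability $1/2$ and $-1$ with probability $1/2$. The energy of site $x$ at time $t$ is $$e_x(t)=-\sum_{y:\{x,y\}\in\mathcal{E}_k}\sigma_x(t)\sigma_y(t),$$ the sum being over the edges at $x$ for the boundary condition in question. Each site has an exponential clock of rate 1 (ringing repeatedly, at the points of a Poisson process), the clocks being independent of each other and of $\sigma(0)$. When the clock of $x$ rings at time $t$: $\sigma_x(t)=-\sigma_x(t^-)$ if $e_x(t^-)>0$; $\sigma_x(t)=\pm1$ with probability $1/2$ each (by an independent fair coin) if $e_x(t^-)=0$; $\sigma_x(t)=\sigma_x(t^-)$ if $e_x(t^-)<0$. Let $\omega$ denote the realization of the dynamics (clocks and coins), and $\mathbb{P}$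 the joint distribution of $(\sigma(0),\omega)$. The slab $S_k$ (with given boundary conditions) fixates if, $\mathbb{P}$-almost surely, for every site $v\in S_k$ there exists $T=T_v(\sigma(0),\omega)<\infty$ such that $\sigma_v(t)=\sigma_v(T)$ for all $t\ge T$. "Does not fixate" is the negation: the probability that every site $v\in S_k$ has an eventually constant spin is strictly less than 1. *)

theory Defs
  imports "HOL-Probability.Probability"
begin

type_synonym site = "int \<times> int \<times> nat"

text \<open>A configuration is only meaningful on the sites of the slab, where its values are in
  \<open>{-1, 1}\<close>.\<close>

type_synonym config = "site \<Rightarrow> int"

datatype boundary = Free | Periodic

definition slab :: "nat \<Rightarrow> site set" where
  "slab k = UNIV \<times> UNIV \<times> {..<k}"

fun l1_dist :: "site \<Rightarrow> site \<Rightarrow> int" where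
  "l1_dist (a, b, c) (a', b', c') = \<bar>a - a'\<bar> + \<bar>b - b'\<bar> + \<bar>int c - int c'\<bar>"

definition slab_edges :: "boundary \<Rightarrow> nat \<Rightarrow> site set set" where
  "slab_edges bc k =
     {{x, y} | x y. x \<in> slab k \<and> y \<in> slab k \<and> l1_dist x y = 1} \<union>
     (case bc of
        Free \<Rightarrow> {}
      | Periodic \<Rightarrow> {{(a, b, k - 1), (a, b, 0)} | a b. True})"

definition energy :: "boundary \<Rightarrow> nat \<Rightarrow> config \<Rightarrow> site \<Rightarrow> int" where
  "energy bc k s x = - (\<Sum>y | {x, y} \<in> slab_edges bc k. s x * s y)"

definition left_config :: "(real \<Rightarrow> config) \<Rightarrow> real \<Rightarrow> config" where
  "left_config s t = (\<lambda>y. Lim (at_left t) (\<lambda>r. s r y))"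

text \<open>The clock of a site is a Poisson process of rate 1, given by its independent exponential
  waiting times. The rings are numbered from 0.\<close>

definition ring_time :: "(nat \<Rightarrow> real) \<Rightarrow> nat \<Rightarrow> real" where
  "ring_time w n = (\<Sum>i\<le>n. w i)"

text \<open>Here \<open>w x\<close> are the waiting times of the clock of \<open>x\<close>, and \<open>c x n\<close> is the coin attached
  to its \<open>n\<close>-th ring, which is consulted only if the energy vanishes. Since a ring at
  time \<open>r\<close> does not prevent \<open>s t x = s r x\<close>, trajectories are right-continuous.\<close>

definition glauber_trajectory ::
  "boundary \<Rightarrow> nat \<Rightarrow> (site \<Rightarrow> nat \<Rightarrow> real) \<Rightarrow> (site \<Rightarrow> nat \<Rightarrow> int) \<Rightarrow> (real \<Rightarrow> config) \<Rightarrow> bool"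
where
  "glauber_trajectory bc k w c s \<longleftrightarrow>
     (\<forall>x\<in>slab k. \<forall>t\<ge>0. s t x \<in> {-1, 1}) \<and>
     (\<forall>x\<in>slab k. \<forall>r t. 0 \<le> r \<and> r \<le> t \<and> (\<forall>n. ring_time (w x) n \<notin> {r<..t}) \<longrightarrow> s t x = s r x) \<and>
     (\<forall>x\<in>slab k. \<forall>n.
        let t = ring_time (w x) n; s' = left_config s t; e = energy bc k s' x
        in s t x = (if e > 0 then - s' x else if e = 0 then c x n else s' x))"

text \<open>The sources of randomness, real-valued so that they form a single independent family.\<close>

datatype source = Init site | Wait site nat | Coin site nat

definition sources :: "nat \<Rightarrow> source set" where
  "sources k = Init ` slab k \<union> (\<Union>x\<in>slab k. range (Wait x) \<union> range (Coin x))"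

fun noise ::
  "(real \<Rightarrow> 'a \<Rightarrow> config) \<Rightarrow> (site \<Rightarrow> nat \<Rightarrow> 'a \<Rightarrow> real) \<Rightarrow> (site \<Rightarrow> nat \<Rightarrow> 'a \<Rightarrow> int)
     \<Rightarrow> source \<Rightarrow> 'a \<Rightarrow> real" where
  "noise \<sigma> W C (Init x) \<omega> = of_int (\<sigma> 0 \<omega> x)"
| "noise \<sigma> W C (Wait x n) \<omega> = W x n \<omega>"
| "noise \<sigma> W C (Coin x n) \<omega> = of_int (C x n \<omega>)"

text \<open>A realization of the zero-temperature Glauber dynamics started from i.i.d. symmetric spins:
  \<open>\<sigma> t \<omega>\<close> is the configuration at time \<open>t\<close>, driven by the waiting times \<open>W\<close> and coins \<open>C\<close>.
  The sources of randomness almost surely determine \<open>\<sigma>\<close> on the slab (Harris' graphical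
  construction), so its law does not depend on the realization.\<close>

locale slab_glauber = prob_space M
  for M :: "'a measure" and bc :: boundary and k :: nat
    and \<sigma> :: "real \<Rightarrow> 'a \<Rightarrow> config"
    and W :: "site \<Rightarrow> nat \<Rightarrow> 'a \<Rightarrow> real"
    and C :: "site \<Rightarrow> nat \<Rightarrow> 'a \<Rightarrow> int" +
  assumes spin_measurable:
    "\<And>t x. 0 \<le> t \<Longrightarrow> x \<in> slab k \<Longrightarrow> (\<lambda>\<omega>. \<sigma> t \<omega> x) \<in> M \<rightarrow>\<^sub>M count_space UNIV"
  and coin_measurable:
    "\<And>x n. x \<in> slab k \<Longrightarrow> C x n \<in> M \<rightarrow>\<^sub>M count_space UNIV"
  and independent: "indep_vars (\<lambda>_. borel) (noise \<sigma> W C) (sources k)"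
  and initial_spin:
    "\<And>x. x \<in> slab k \<Longrightarrow> prob {\<omega> \<in> space M. \<sigma> 0 \<omega> x = 1} = 1 / 2"
    "\<And>x. x \<in> slab k \<Longrightarrow> prob {\<omega> \<in> space M. \<sigma> 0 \<omega> x = -1} = 1 / 2"
  and waiting_time:
    "\<And>x n. x \<in> slab k \<Longrightarrow> distributed M lborel (W x n) (exponential_density 1)"
  and coin:
    "\<And>x n. x \<in> slab k \<Longrightarrow> prob {\<omega> \<in> space M. C x n \<omega> = 1} = 1 / 2"
    "\<And>x n. x \<in> slab k \<Longrightarrow> prob {\<omega> \<in> space M. C x n \<omega> = -1} = 1 / 2"
  and dynamics:
    "AE \<omega> in M. glauber_trajectory bc k (\<lambda>x n. W x n \<omega>) (\<lambda>x n. C x n \<omega>) (\<lambda>t. \<sigma> t \<omega>)"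

definition fixates :: "'a measure \<Rightarrow> nat \<Rightarrow> (real \<Rightarrow> 'a \<Rightarrow> config) \<Rightarrow> bool" where
  "fixates M k \<sigma> \<longleftrightarrow>
     (AE \<omega> in M. \<forall>v\<in>slab k. \<exists>T\<ge>0. \<forall>t\<ge>T. \<sigma> t \<omega> v = \<sigma> T \<omega> v)"

end

(* It suffices to exhibit a finite pattern of spins that no sequence of clock rings and coins can
   change, together with finitely many further sites at which no assignment of spins is stable: the
   pattern occurs initially with positive probability, and then one of these sites keeps flipping.
   Every spin of the pattern agrees with a strict majority of its neighbours whatever the spins
   outside the pattern are, so by induction on the number of rings it never changes. The unstable
   sites form a row of four, with a minus at one end and a plus at the other, and the other
   neighbours of each of them are two pluses and two minuses. A domain wall therefore performs
   a random walk in the row: if the spins of the row were eventually constant, some site of it would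
   have nonnegative energy forever, and would be flipped by a later ring. *)
theory Submission
  imports Defs
begin

section \<open>Energies\<close>

definition vertical_sum :: "boundary \<Rightarrow> nat \<Rightarrow> (nat \<Rightarrow> int) \<Rightarrow> nat \<Rightarrow> int" where
  "vertical_sum bc k f c =
     (if Suc c < k then f (Suc c) else if bc = Periodic then f 0 else 0) +
     (if 0 < c then f (c - 1) else if bc = Periodic then f (k - 1) else 0)"

definition nbr_sum :: "boundary \<Rightarrow> nat \<Rightarrow> (site \<Rightarrow> int) \<Rightarrow> site \<Rightarrow> int" where
  "nbr_sum bc k f = (\<lambda>(a, b, c). f (a + 1, b, c) + f (a - 1, b, c) + f (a, b + 1, c) + f (a, b - 1, c) +
     vertical_sum bc k (\<lambda>l. f (a, b, l)) c)"

definition vertical_nbrs :: "boundary \<Rightarrow> nat \<Rightarrow> nat \<Rightarrow> nat set" where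
  "vertical_nbrs bc k c =
     (if Suc c < k then {Suc c} else if bc = Periodic then {0} else {}) \<union>
     (if 0 < c then {c - 1} else if bc = Periodic then {k - 1} else {})"

text \<open>With at least three layers the sites above and below are distinct. With two periodic
  layers they would coincide and be counted twice.\<close>

lemma vertical_sum_eq:
  assumes "k \<ge> 3" "c < k"
  shows "vertical_sum bc k f c = sum f (vertical_nbrs bc k c)"
proof -
  have "Suc c \<noteq> c - 1" "k - 1 \<noteq> 0" "c = 0 \<Longrightarrow> Suc c \<noteq> k - 1" "\<not> Suc c < k \<Longrightarrow> c - 1 \<noteq> 0"
    using assms by auto
  then show ?thesis
    using assms unfolding vertical_sum_def vertical_nbrs_def by (simp split: if_splits)
qed

lemma l1_dist_eq_1_iff:
  "l1_dist (a, b, c) (a', b', c') = 1 \<longleftrightarrow>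
     c' = c \<and> (b' = b \<and> (a' = a + 1 \<or> a' = a - 1) \<or> a' = a \<and> (b' = b + 1 \<or> b' = b - 1)) \<or>
     a' = a \<and> b' = b \<and> (c' = Suc c \<or> 0 < c \<and> c' = c - 1)"
proof (cases "c' = c")
  case True
  then show ?thesis by (cases "a' = a") auto
next
  case False
  then have "\<bar>int c - int c'\<bar> \<ge> 1" by simp
  then have "l1_dist (a, b, c) (a', b', c') = 1 \<longleftrightarrow> a' = a \<and> b' = b \<and> \<bar>int c - int c'\<bar> = 1"
    by auto
  also have "\<bar>int c - int c'\<bar> = 1 \<longleftrightarrow> c' = Suc c \<or> 0 < c \<and> c' = c - 1"
    by arith
  finally show ?thesis using False by simp
qed

lemma l1_dist_commute: "l1_dist x y = l1_dist y x"
  by (cases x; cases y) (simp add: abs_minus_commute)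

lemma edge_iff:
  assumes "k \<ge> 3" "c < k"
  shows "{(a, b, c), y} \<in> slab_edges bc k \<longleftrightarrow>
    y \<in> {(a + 1, b, c), (a - 1, b, c), (a, b + 1, c), (a, b - 1, c)} \<union> (\<lambda>l. (a, b, l)) ` vertical_nbrs bc k c"
proof -
  obtain a' b' c' where y: "y = (a', b', c')" by (cases y)
  have planar: "{x, y} \<in> {{x, y} | x y. x \<in> slab k \<and> y \<in> slab k \<and> l1_dist x y = 1} \<longleftrightarrow>
      x \<in> slab k \<and> y \<in> slab k \<and> l1_dist x y = 1" for x
    unfolding mem_Collect_eq doubleton_eq_iff using l1_dist_commute[of x y] by metis
  have wrap: "{(a, b, c), y} \<in> {{(a, b, k - 1), (a, b, 0)} | a b. True} \<longleftrightarrow>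
     a' = a \<and> b' = b \<and> (c = k - 1 \<and> c' = 0 \<or> c = 0 \<and> c' = k - 1)"
    by (auto simp: doubleton_eq_iff y)
  have "{(a, b, c), y} \<in> slab_edges bc k \<longleftrightarrow>
     c' < k \<and> l1_dist (a, b, c) (a', b', c') = 1 \<or>
     bc = Periodic \<and> a' = a \<and> b' = b \<and> (c = k - 1 \<and> c' = 0 \<or> c = 0 \<and> c' = k - 1)"
    unfolding slab_edges_def Un_iff planar
    using assms wrap by (cases bc) (simp_all add: slab_def y del: l1_dist.simps)
  also have "\<dots> \<longleftrightarrow> c' = c \<and> (b' = b \<and> (a' = a + 1 \<or> a' = a - 1) \<or> a' = a \<and> (b' = b + 1 \<or> b' = b - 1)) \<or>
      a' = a \<and> b' = b \<and> c' \<in> vertical_nbrs bc k c"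
    unfolding l1_dist_eq_1_iff using assms by (auto simp: vertical_nbrs_def)
  also have "\<dots> \<longleftrightarrow> y \<in> {(a + 1, b, c), (a - 1, b, c), (a, b + 1, c), (a, b - 1, c)} \<union> (\<lambda>l. (a, b, l)) ` vertical_nbrs bc k c"
    by (auto simp: y)
  finally show ?thesis .
qed

lemma energy_eq:
  assumes "k \<ge> 3" "x \<in> slab k"
  shows "energy bc k s x = - s x * nbr_sum bc k s x"
proof -
  obtain a b c where x: "x = (a, b, c)" by (cases x)
  have c: "c < k" using assms x by (simp add: slab_def)
  let ?H = "{(a + 1, b, c), (a - 1, b, c), (a, b + 1, c), (a, b - 1, c)}"
  let ?V = "(\<lambda>l. (a, b, l)) ` vertical_nbrs bc k c"
  have N: "{y. {x, y} \<in> slab_edges bc k} = ?H \<union> ?V"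
    using edge_iff[OF assms(1) c] unfolding x by blast
  have fin: "finite (vertical_nbrs bc k c)" by (simp add: vertical_nbrs_def)
  have "(\<Sum>y | {x, y} \<in> slab_edges bc k. s y) = sum s ?H + sum s ?V"
    unfolding N using fin by (intro sum.union_disjoint) auto
  also have "sum s ?V = vertical_sum bc k (\<lambda>l. s (a, b, l)) c"
    by (subst sum.reindex) (auto simp: inj_on_def vertical_sum_eq[OF assms(1) c])
  finally show ?thesis
    by (simp add: energy_def x nbr_sum_def flip: sum_distrib_left)
qed

lemma finite_nbrs:
  assumes "k \<ge> 3" "x \<in> slab k"
  shows "finite {y. {x, y} \<in> slab_edges bc k}"
proof -
  obtain a b c where x: "x = (a, b, c)" by (cases x)
  have c: "c < k" using assms x by (simp add: slab_def)
  show ?thesis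
    unfolding x edge_iff[OF assms(1) c] by (simp add: vertical_nbrs_def)
qed

lemma nbrs_subset_slab: "{x, y} \<in> slab_edges bc k \<Longrightarrow> k > 0 \<Longrightarrow> y \<in> slab k"
  by (auto simp: slab_edges_def slab_def doubleton_eq_iff simp del: l1_dist.simps split: boundary.splits)

text \<open>Only values on the slab enter the sum. This serves to compare worst-case agreements with
  actual products of spins.\<close>

lemma nbr_sum_mono:
  assumes "k \<ge> 3" "x \<in> slab k" "\<And>y. y \<in> slab k \<Longrightarrow> f y \<le> g y"
  shows "nbr_sum bc k f x \<le> nbr_sum bc k g x"
proof -
  obtain a b c where x: "x = (a, b, c)" by (cases x)
  have c: "c < k" using assms x by (simp add: slab_def)
  have "f (a', b', c') \<le> g (a', b', c')" if "c' < k" for a' b' c'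
    using assms(3) that by (simp add: slab_def)
  then show ?thesis
    using c assms(1) unfolding x nbr_sum_def vertical_sum_def prod.case
    by (intro add_mono) auto
qed

section \<open>Trajectories\<close>

text \<open>The two almost sure properties on which the pathwise arguments rest. Unboundedness
  excludes an accumulation of rings.\<close>

definition regular_clock :: "(nat \<Rightarrow> real) \<Rightarrow> bool" where
  "regular_clock u \<longleftrightarrow> (\<forall>n. 0 < u n) \<and> (\<forall>t. \<exists>n. t < ring_time u n)"

lemma ring_time_mono:
  assumes "regular_clock u" "m \<le> n"
  shows "ring_time u m \<le> ring_time u n"
  unfolding ring_time_def using assms by (intro sum_mono2) (auto simp: regular_clock_def less_imp_le)

lemma ring_time_pos: "regular_clock u \<Longrightarrow> 0 < ring_time u n"
  unfolding ring_time_def by (intro sum_pos) (auto simp: regular_clock_def)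

lemma finite_rings:
  assumes "regular_clock u"
  shows "finite {n. ring_time u n \<le> t}"
proof -
  obtain m where m: "t < ring_time u m" using assms by (auto simp: regular_clock_def)
  have "{n. ring_time u n \<le> t} \<subseteq> {..<m}"
    using ring_time_mono[OF assms] m by (force simp: not_less[symmetric])
  then show ?thesis by (rule finite_subset) simp
qed

lemma eventually_ring_time_gt:
  assumes "regular_clock u"
  shows "eventually (\<lambda>n. t < ring_time u n) sequentially"
proof -
  obtain m where "t < ring_time u m" using assms by (auto simp: regular_clock_def)
  then show ?thesis
    using ring_time_mono[OF assms] unfolding eventually_sequentially by (meson less_le_trans)
qed

lemma eventually_no_ring:
  assumes "regular_clock u"
  shows "eventually (\<lambda>r. \<forall>n. ring_time u n \<notin> {r<..<t}) (at_left t)"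
proof -
  have "eventually (\<lambda>r. \<forall>n\<in>{n. ring_time u n < t}. ring_time u n < r) (at_left t)"
  proof (rule eventually_ball_finite)
    show "finite {n. ring_time u n < t}"
      by (rule finite_subset[OF _ finite_rings[OF assms, of t]]) auto
    show "\<forall>n\<in>{n. ring_time u n < t}. eventually (\<lambda>r. ring_time u n < r) (at_left t)"
      by (auto intro: eventually_at_leftI)
  qed
  then show ?thesis
  proof eventually_elim
    case (elim r)
    show ?case
    proof (intro allI notI)
      fix n assume n: "ring_time u n \<in> {r<..<t}"
      then have "ring_time u n < r" using elim by simp
      with n show False by simp
    qed
  qed
qed

section \<open>Spins between rings and their left limits\<close>

lemma trajectory_value:
  assumes "glauber_trajectory bc k w c s" "x \<in> slab k" "0 \<le> t"
  shows "s t x \<in> {-1, 1}"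
  using assms unfolding glauber_trajectory_def by blast

lemma trajectory_constant:
  assumes "glauber_trajectory bc k w c s" "x \<in> slab k" "0 \<le> r" "r \<le> t"
    and "\<And>n. ring_time (w x) n \<notin> {r<..t}"
  shows "s t x = s r x"
  using assms unfolding glauber_trajectory_def by blast

text \<open>The spin is constant between the last ring before \<open>t\<close> and \<open>t\<close>,
  so the limit in \<open>left_config\<close> is a value taken shortly before
  \<open>t\<close>.\<close>

lemma eventually_left_config:
  assumes traj: "glauber_trajectory bc k w c s" and y: "y \<in> slab k"
    and reg: "regular_clock (w y)" and t: "0 < t"
  shows "eventually (\<lambda>r. s r y = left_config s t y) (at_left t)"
proof -
  have "eventually (\<lambda>r. 0 < r) (at_left t)"
    using t by (auto intro: eventually_at_leftI)
  moreover have "eventually (\<lambda>r. r < t) (at_left t)"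
    by (rule eventually_at_leftI[of 0]) (use t in auto)
  ultimately have "eventually (\<lambda>r. 0 < r \<and> r < t \<and> (\<forall>n. ring_time (w y) n \<notin> {r<..<t})) (at_left t)"
    using eventually_no_ring[OF reg, of t] by eventually_elim auto
  then obtain r0 where r0: "0 < r0" "r0 < t" "\<And>n. ring_time (w y) n \<notin> {r0<..<t}"
    by (blast dest: eventually_happens'[OF trivial_limit_at_left_real])
  have const: "s r y = s r0 y" if "r0 < r" "r < t" for r
  proof -
    have "ring_time (w y) n \<notin> {r0<..r}" for n
      using r0(3)[of n] that by auto
    then show ?thesis
      using r0(1) that by (intro trajectory_constant[OF traj y]) simp_all
  qed
  then have ev: "eventually (\<lambda>r. s r y = s r0 y) (at_left t)"
    by (intro eventually_at_leftI[of r0]) (use r0(2) in auto)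
  have "left_config s t y = s r0 y"
    unfolding left_config_def
    using ev by (intro tendsto_Lim tendsto_eventually) simp_all
  with ev show ?thesis by simp
qed

lemma left_config_value:
  assumes "glauber_trajectory bc k w c s" "y \<in> slab k" "regular_clock (w y)" "0 < t"
  shows "left_config s t y \<in> {-1, 1}"
proof -
  have "eventually (\<lambda>r. s r y = left_config s t y \<and> 0 < r) (at_left t)"
    using assms(4) by (intro eventually_conj eventually_left_config[OF assms]) (auto intro: eventually_at_leftI)
  then obtain r where "s r y = left_config s t y" "0 < r"
    by (blast dest: eventually_happens'[OF trivial_limit_at_left_real])
  moreover have "s r y \<in> {-1, 1}"
    using \<open>0 < r\<close> by (intro trajectory_value[OF assms(1,2)]) simp
  ultimately show ?thesis by simp
qed

lemma ring_update:
  assumes "glauber_trajectory bc k w c s" "x \<in> slab k"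
  defines "t \<equiv> ring_time (w x)"
  shows "s (t n) x = (if energy bc k (left_config s (t n)) x > 0 then - left_config s (t n) x
      else if energy bc k (left_config s (t n)) x = 0 then c x n else left_config s (t n) x)"
  using assms unfolding glauber_trajectory_def Let_def by blast

text \<open>The value 0 stands for an unspecified spin. Quantifying over all completions
  \<open>s\<close> lets the spins outside the pattern evolve arbitrarily.\<close>

definition stable_pattern :: "boundary \<Rightarrow> nat \<Rightarrow> config \<Rightarrow> bool" where
  "stable_pattern bc k \<eta> \<longleftrightarrow>
     (\<forall>s. (\<forall>y\<in>slab k. s y \<in> {-1, 1}) \<longrightarrow> (\<forall>y. \<eta> y \<noteq> 0 \<longrightarrow> s y = \<eta> y) \<longrightarrow>
        (\<forall>x. \<eta> x \<noteq> 0 \<longrightarrow> energy bc k s x < 0))"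

text \<open>Strong induction on the number of rings at pattern sites. Just before the last ring of
  \<open>x\<close> the pattern is intact by induction, so the energy is negative and the ring
  changes nothing.\<close>

lemma stable_pattern_invariant:
  assumes traj: "glauber_trajectory bc k w c s" and reg: "\<And>x. x \<in> slab k \<Longrightarrow> regular_clock (w x)"
    and S: "finite {x. \<eta> x \<noteq> 0}" "{x. \<eta> x \<noteq> 0} \<subseteq> slab k"
    and stable: "stable_pattern bc k \<eta>"
    and init: "\<And>x. \<eta> x \<noteq> 0 \<Longrightarrow> s 0 x = \<eta> x"
    and "\<eta> x \<noteq> 0" "0 \<le> t"
  shows "s t x = \<eta> x"
proof -
  let ?S = "{x. \<eta> x \<noteq> 0}"
  let ?R = "\<lambda>x t. {n. ring_time (w x) n \<le> t}"
  \<comment> \<open>Only the clocks of the finite pattern are counted, so the count is finite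
    although the slab is infinite.\<close>
  define N where "N t = (\<Sum>x\<in>?S. card (?R x t))" for t
  show ?thesis
    using assms(7,8)
  proof (induction "N t" arbitrary: t x rule: less_induct)
    case less
    have x: "x \<in> slab k" using S less.prems by auto
    note rx = reg[OF x]
    have const: "s t x = s r x" if "0 \<le> r" "r \<le> t" "\<And>n. ring_time (w x) n \<notin> {r<..t}" for r
      using that by (rule trajectory_constant[OF traj x])
    show ?case
    proof (cases "?R x t = {}")
      case True
      then have "s t x = s 0 x" using less.prems by (intro const) auto
      then show ?thesis using init less.prems by simp
    next
      case False
      define n where "n = Max (?R x t)"
      define \<tau> where "\<tau> = ring_time (w x) n"
      have "n \<in> ?R x t"
        unfolding n_def using False finite_rings[OF rx] by (intro Max_in) auto
      then have \<tau>: "0 < \<tau>" "\<tau> \<le> t"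
        using ring_time_pos[OF rx] by (auto simp: \<tau>_def)
      have "ring_time (w x) m \<notin> {\<tau><..t}" for m
      proof
        assume m: "ring_time (w x) m \<in> {\<tau><..t}"
        then have "m \<le> n"
          unfolding n_def using finite_rings[OF rx] by (intro Max_ge) auto
        then show False
          using ring_time_mono[OF rx, of m n] m by (simp add: \<tau>_def)
      qed
      then have st: "s t x = s \<tau> x" using \<tau> by (intro const) auto
      have left: "left_config s \<tau> y = \<eta> y" if "\<eta> y \<noteq> 0" for y
      proof -
        have y: "y \<in> slab k" using S that by auto
        have "eventually (\<lambda>r. s r y = left_config s \<tau> y \<and> 0 < r \<and> r < \<tau>) (at_left \<tau>)"
          using eventually_left_config[OF traj y reg[OF y] \<tau>(1)] \<tau>(1)
          by (intro eventually_conj) (auto intro: eventually_at_leftI)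
        then obtain r where r: "s r y = left_config s \<tau> y" "0 < r" "r < \<tau>"
          by (blast dest: eventually_happens'[OF trivial_limit_at_left_real])
        \<comment> \<open>Before \<tau> the ring \<open>n\<close> of \<open>x\<close> has not been
          counted, so the induction hypothesis applies at time \<open>r\<close>.\<close>
        have "N r < N t"
          unfolding N_def
        proof (rule sum_strict_mono_ex1)
          show "\<forall>z\<in>?S. card (?R z r) \<le> card (?R z t)"
            using r \<tau> S reg by (auto intro!: card_mono finite_rings)
          have "?R x r \<subset> ?R x t"
            using r \<tau> by (auto simp: \<tau>_def psubset_eq) (metis \<open>n \<in> ?R x t\<close> linorder_not_less mem_Collect_eq)
          then have "card (?R x r) < card (?R x t)"
            by (intro psubset_card_mono finite_rings[OF rx])
          then show "\<exists>z\<in>?S. card (?R z r) < card (?R z t)"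
            using less.prems by blast
        qed (use S in auto)
        then have "s r y = \<eta> y" using less.hyps that r by simp
        then show ?thesis using r by simp
      qed
      have "energy bc k (left_config s \<tau>) x < 0"
        using stable left left_config_value[OF traj _ reg \<tau>(1)] less.prems
        unfolding stable_pattern_def by blast
      then show ?thesis
        using ring_update[OF traj x, of n] left less.prems st by (simp add: \<tau>_def)
    qed
  qed
qed

text \<open>If the spin were frozen from \<open>T\<close> on, a later ring whose coin opposes it
  would give a contradiction: positive energy forces a flip, and at zero energy the coin flips
  it.\<close>

lemma not_eventually_constant:
  assumes traj: "glauber_trajectory bc k w c s" and reg: "\<And>x. x \<in> slab k \<Longrightarrow> regular_clock (w x)"
    and k: "k \<ge> 3" and x: "x \<in> slab k" and T: "0 \<le> T"
    and energy: "\<And>t. T \<le> t \<Longrightarrow> 0 \<le> energy bc k (s t) x"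
    and coins: "\<And>v. v \<in> {-1, 1} \<Longrightarrow> \<exists>\<^sub>\<infinity>n. c x n = v"
  shows "\<exists>t\<ge>T. s t x \<noteq> s T x"
proof (rule ccontr)
  assume "\<not> ?thesis"
  then have const: "s t x = s T x" if "T \<le> t" for t using that by blast
  have v: "s T x \<in> {-1, 1}"
    by (rule trajectory_value[OF traj x T])
  then have "- s T x \<in> {-1, 1}" by auto
  then have "\<exists>\<^sub>\<infinity>n. c x n = - s T x" by (rule coins)
  then have "\<exists>\<^sub>\<infinity>n. c x n = - s T x \<and> T < ring_time (w x) n"
    using eventually_ring_time_gt[OF reg[OF x], of T]
    by (simp add: frequently_eventually_frequently cofinite_eq_sequentially)
  then obtain n where n: "c x n = - s T x" "T < ring_time (w x) n"
    by (auto dest: INFM_EX)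
  define \<tau> where "\<tau> = ring_time (w x) n"
  have \<tau>: "T < \<tau>" "0 < \<tau>" using n T by (auto simp: \<tau>_def)
  let ?B = "insert x {y. {x, y} \<in> slab_edges bc k}"
  \<comment> \<open>A site has finitely many neighbours, so a single time \<open>r\<close> before
    the ring shows the left limits of all spins in the energy.\<close>
  have "eventually (\<lambda>r. (\<forall>y\<in>?B. s r y = left_config s \<tau> y) \<and> T < r) (at_left \<tau>)"
  proof (rule eventually_conj)
    show "eventually (\<lambda>r. \<forall>y\<in>?B. s r y = left_config s \<tau> y) (at_left \<tau>)"
    proof (rule eventually_ball_finite)
      show "\<forall>y\<in>?B. eventually (\<lambda>r. s r y = left_config s \<tau> y) (at_left \<tau>)"
        using eventually_left_config[OF traj _ _ \<tau>(2)] reg x nbrs_subset_slab k by auto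
    qed (use finite_nbrs[OF k x] in auto)
  qed (use \<tau> in \<open>auto intro: eventually_at_leftI\<close>)
  then obtain r where r: "\<forall>y\<in>?B. s r y = left_config s \<tau> y" "T < r"
    by (blast dest: eventually_happens'[OF trivial_limit_at_left_real])
  have "energy bc k (left_config s \<tau>) x = energy bc k (s r) x"
    unfolding energy_def using r by (intro arg_cong[where f = uminus] sum.cong) auto
  moreover have "left_config s \<tau> x = s T x" using r const[of r] by simp
  ultimately have "s \<tau> x = - s T x"
    using ring_update[OF traj x, of n] energy[of r] r n by (auto simp: \<tau>_def)
  then show False using const[of \<tau>] \<tau> v by auto
qed

section \<open>The pattern\<close>

text \<open>For a spin \<open>p\<close>, an unspecified \<open>q = 0\<close> counts as a
  disagreement. Hence this bounds from below the product of the two spins in every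
  completion.\<close>

definition agree :: "int \<Rightarrow> int \<Rightarrow> int" where
  "agree p q = (if p = q then 1 else -1)"

text \<open>The layers 0, 1, 2 and 3 of the pattern, with the unstable row shown as dots:
\<^verbatim>\<open>
    ++++++++++++   ++++++++++++   ++++++++++++   ++++++++++++
    +--++--++--+   +------++--+   +----------+   +--++------+
    +--++--++--+   +------++--+   +----------+   +--++------+
    ++++++++++++   +++++++++--+   +----------+   +--+++++++++
    ++++++++++++   +++++++++--+   +----------+   +--+++++++++
    +--+++++++++   +--....++--+   +----------+   +--+++++++++
    +--++--++--+   +------++--+   +----------+   +--++------+
    +--++--++--+   +------++--+   +----------+   +--++------+
    ++++++++++++   ++++++++++++   ++++++++++++   ++++++++++++\<close>
  The value 0 marks the sites outside the pattern. The pattern was found by a SAT solver. Layers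
  above the third repeat it, which makes the pattern stable for all heights and both boundary
  conditions.\<close>

definition pattern :: "int \<Rightarrow> int \<Rightarrow> nat \<Rightarrow> int" where
  "pattern a b l =
     (if a \<notin> {0..11} \<or> b \<notin> {0..8} \<or> (l = 1 \<and> b = 5 \<and> a \<in> {3..6}) then 0
      else if a \<in> {0, 11} \<or> b \<in> {0, 8} \<or>
        l \<in> {0, 1} \<and> (a \<in> {7, 8} \<or> a \<le> 8 \<and> b \<in> {3, 4}) \<or>
        l \<in> {0, 3} \<and> (a \<in> {3, 4} \<or> 3 \<le> a \<and> b \<in> {3..5}) then 1
      else -1)"

definition slab_pattern :: "nat \<Rightarrow> config" where
  "slab_pattern k = (\<lambda>(a, b, c). if c < k then pattern a b (min c 3) else 0)"

definition planar_margin :: "int \<Rightarrow> int \<Rightarrow> nat \<Rightarrow> int" where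
  "planar_margin a b l =
     agree (pattern a b l) (pattern (a + 1) b l) + agree (pattern a b l) (pattern (a - 1) b l) +
     agree (pattern a b l) (pattern a (b + 1) l) + agree (pattern a b l) (pattern a (b - 1) l)"

definition vertical_margin :: "int \<Rightarrow> int \<Rightarrow> nat \<Rightarrow> nat \<Rightarrow> int" where
  "vertical_margin a b l m = agree (pattern a b l) (pattern a b m)"

text \<open>The vertical neighbours of a site depend on the height and the boundary condition. These are
  the least favourable cases.\<close>

definition margins_positive :: "int \<Rightarrow> int \<Rightarrow> bool" where
  "margins_positive a b \<longleftrightarrow>
     planar_margin a b 0 + vertical_margin a b 0 1 > 0 \<and>
     planar_margin a b 0 + vertical_margin a b 0 1 + vertical_margin a b 0 3 > 0 \<and>
     (pattern a b 1 \<noteq> 0 \<longrightarrow>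
       planar_margin a b 1 + vertical_margin a b 1 0 + vertical_margin a b 1 2 > 0) \<and>
     planar_margin a b 2 + vertical_margin a b 2 1 > 0 \<and>
     planar_margin a b 2 + vertical_margin a b 2 1 + vertical_margin a b 2 3 > 0 \<and>
     planar_margin a b 3 + vertical_margin a b 3 2 > 0 \<and>
     planar_margin a b 3 + vertical_margin a b 3 0 + vertical_margin a b 3 2 > 0"

text \<open>A finite check: the pattern is evaluated in each of the 108 columns.\<close>

lemma margins_positive_box:
  assumes "a \<in> {0..11}" "b \<in> {0..8}"
  shows "margins_positive a b"
proof -
  have "a = 0 \<or> a = 1 \<or> a = 2 \<or> a = 3 \<or> a = 4 \<or> a = 5 \<or>
      a = 6 \<or> a = 7 \<or> a = 8 \<or> a = 9 \<or> a = 10 \<or> a = 11"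
    using assms(1) by (simp, presburger)
  moreover have "b = 0 \<or> b = 1 \<or> b = 2 \<or> b = 3 \<or> b = 4 \<or> b = 5 \<or> b = 6 \<or> b = 7 \<or> b = 8"
    using assms(2) by (simp, presburger)
  ultimately show ?thesis
    by (elim disjE; simp add: margins_positive_def planar_margin_def vertical_margin_def
        pattern_def agree_def)
qed

section \<open>From the margins to stability in the slab\<close>

lemma vertical_margin_le: "vertical_margin a b l m \<le> 1"
  by (simp add: vertical_margin_def agree_def)

lemma vertical_margin_refl: "vertical_margin a b l l = 1"
  by (simp add: vertical_margin_def agree_def)

lemma slab_pattern_value: "slab_pattern k x \<noteq> 0 \<Longrightarrow> slab_pattern k x \<in> {-1, 1}"
  by (cases x) (auto simp: slab_pattern_def pattern_def split: if_splits)

lemma slab_pattern_support: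
  "finite {x. slab_pattern k x \<noteq> 0}" "{x. slab_pattern k x \<noteq> 0} \<subseteq> slab k"
proof -
  have sub: "{x. slab_pattern k x \<noteq> 0} \<subseteq> {0..11} \<times> {0..8} \<times> {..<k}"
    by (auto simp: slab_pattern_def pattern_def split: if_splits)
  show "finite {x. slab_pattern k x \<noteq> 0}"
    by (rule finite_subset[OF sub]) auto
  show "{x. slab_pattern k x \<noteq> 0} \<subseteq> slab k"
    using sub by (auto simp: slab_def)
qed

text \<open>The height and the boundary condition determine the layers above and below; each case
  reduces to an inequality of \<open>margins_positive\<close>.\<close>

lemma slab_pattern_margin:
  assumes k: "k \<ge> 3" "bc = Periodic \<Longrightarrow> k \<ge> 4" and nz: "slab_pattern k x \<noteq> 0"
  shows "nbr_sum bc k (\<lambda>y. agree (slab_pattern k x) (slab_pattern k y)) x > 0"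
proof -
  obtain a b c where x: "x = (a, b, c)" by (cases x)
  define l where "l = min c 3"
  have c: "c < k" "pattern a b l \<noteq> 0"
    using nz by (auto simp: x slab_pattern_def l_def split: if_splits)
  then have m: "margins_positive a b"
    by (intro margins_positive_box) (auto simp: pattern_def split: if_splits)
  have eq: "nbr_sum bc k (\<lambda>y. agree (slab_pattern k x) (slab_pattern k y)) x =
     planar_margin a b l + vertical_sum bc k (\<lambda>c'. vertical_margin a b l (min c' 3)) c"
    using c k less_imp_diff_less[OF c(1), of 1] by (simp add: nbr_sum_def x planar_margin_def slab_pattern_def vertical_margin_def
        vertical_sum_def l_def)
  consider "c = 0" | "c = 1" | "c = 2" | "c = 3" | "c > 3" by linarith
  then show ?thesis
  proof cases
    case 1
    \<comment> \<open>With at least four periodic layers, the site joined to height 0 by the wrap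
      lies in a copy of layer 3.\<close>
    have "min (k - 1) 3 = 3" if "bc = Periodic" using k that by auto
    with 1 show ?thesis
      unfolding eq using m k c by (cases bc) (auto simp: l_def vertical_sum_def margins_positive_def)
  next
    case 2
    then show ?thesis
      unfolding eq using m k c
      by (auto simp: l_def vertical_sum_def margins_positive_def min_def numeral_2_eq_2)
  next
    case 3
    then show ?thesis
      unfolding eq using m k c
      by (cases "k = 3"; cases bc) (auto simp: l_def vertical_sum_def margins_positive_def min_def)
  next
    case 4
    then show ?thesis
      unfolding eq using m k c
      by (cases "k = 4"; cases bc) (auto simp: l_def vertical_sum_def margins_positive_def min_def vertical_margin_refl)
  next
    case 5
    \<comment> \<open>The site below has the same spin and contributes 1, at least the margin of
      layer 3 against layer 2. Thus the inequalities for layer 3 suffice.\<close>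
    have "min c 3 = 3" "min (Suc c) 3 = 3" "min (c - 1) 3 = 3" using 5 by auto
    with 5 show ?thesis
      unfolding eq using m k c vertical_margin_le[of a b 3 2]
      by (cases "Suc c < k"; cases bc) (auto simp: l_def vertical_sum_def margins_positive_def vertical_margin_refl)
  qed
qed

lemma stable_slab_pattern:
  assumes "k \<ge> 3" "bc = Periodic \<Longrightarrow> k \<ge> 4"
  shows "stable_pattern bc k (slab_pattern k)"
  unfolding stable_pattern_def
proof (intro allI impI)
  fix s x
  let ?\<eta> = "slab_pattern k"
  assume s: "\<forall>y\<in>slab k. s y \<in> {-1, 1}" and \<eta>: "\<forall>y. ?\<eta> y \<noteq> 0 \<longrightarrow> s y = ?\<eta> y"
    and nz: "?\<eta> x \<noteq> 0"
  have x: "x \<in> slab k" using slab_pattern_support nz by auto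
  have sx: "s x = ?\<eta> x" using \<eta> nz by blast
  have "0 < nbr_sum bc k (\<lambda>y. agree (?\<eta> x) (?\<eta> y)) x"
    by (rule slab_pattern_margin[OF assms nz])
  also have "\<dots> \<le> nbr_sum bc k (\<lambda>y. s x * s y) x"
  proof (rule nbr_sum_mono[OF assms(1) x])
    fix y assume "y \<in> slab k"
    then have "s y \<in> {-1, 1}" "s x \<in> {-1, 1}" using s x by auto
    moreover have "s y = ?\<eta> y" if "?\<eta> y \<noteq> 0" using \<eta> that by blast
    ultimately show "agree (?\<eta> x) (?\<eta> y) \<le> s x * s y"
      using nz sx by (cases "?\<eta> x = ?\<eta> y") (auto simp: agree_def)
  qed
  also have "\<dots> = s x * nbr_sum bc k s x"
    by (cases x) (simp add: nbr_sum_def vertical_sum_def algebra_simps)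
  finally show "energy bc k s x < 0"
    by (simp add: energy_eq[OF assms(1) x])
qed

section \<open>The unstable row\<close>

lemma wall_energy:
  assumes k: "k \<ge> 3" and \<eta>: "\<And>y. slab_pattern k y \<noteq> 0 \<Longrightarrow> s y = slab_pattern k y"
    and a: "a \<in> {3..6}"
  shows "energy bc k s (a, 5, 1) = - s (a, 5, 1) * (s (a + 1, 5, 1) + s (a - 1, 5, 1))"
proof -
  have "s (a, 4, 1) = 1" "s (a, 6, 1) = -1" "s (a, 5, 0) = 1" "s (a, 5, 2) = -1"
    using a k \<eta>[of "(a, 4, 1)"] \<eta>[of "(a, 6, 1)"] \<eta>[of "(a, 5, 0)"] \<eta>[of "(a, 5, 2)"]
    by (simp_all add: slab_pattern_def pattern_def)
  then show ?thesis
    using a k by (subst energy_eq[OF k]) (auto simp: slab_def nbr_sum_def vertical_sum_def numeral_2_eq_2)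
qed

lemma wall_ends:
  assumes k: "k \<ge> 3" and \<eta>: "\<And>y. slab_pattern k y \<noteq> 0 \<Longrightarrow> s y = slab_pattern k y"
  shows "s (2, 5, 1) = -1" "s (7, 5, 1) = 1"
  using k \<eta>[of "(2, 5, 1)"] \<eta>[of "(7, 5, 1)"] by (simp_all add: slab_pattern_def pattern_def)

text \<open>Negative energy forces both row neighbours of a site to agree with it. If this held
  throughout the row, the minus at one end would propagate to the plus at the other.\<close>

lemma wall_unstable:
  assumes k: "k \<ge> 3" and s: "\<And>y. y \<in> slab k \<Longrightarrow> s y \<in> {-1, 1}"
    and \<eta>: "\<And>y. slab_pattern k y \<noteq> 0 \<Longrightarrow> s y = slab_pattern k y"
  shows "\<exists>a\<in>{3..6}. energy bc k s (a, 5, 1) \<ge> 0"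
proof (rule ccontr)
  assume "\<not> ?thesis"
  then have neg: "energy bc k s (a, 5, 1) < 0" if "a \<in> {3..6}" for a
    using that by (meson not_le)
  have free: "s (a, 5, 1) \<in> {-1, 1}" for a
    using k by (intro s) (simp add: slab_def)
  have step: "s (a, 5, 1) = -1 \<and> s (a + 1, 5, 1) = -1" if "a \<in> {3..6}" "s (a - 1, 5, 1) = -1" for a
    using neg[OF that(1)] wall_energy[OF k \<eta> that(1), of bc] that(2) free[of a] free[of "a + 1"] by auto
  have "s (7, 5, 1) = -1"
    \<comment> \<open>The minus passes from 2 to 3 and 4, from 4 to 5 and 6, and from 5 to 6 and
      7.\<close>
    using step[of 3] step[of 5] step[of 6] wall_ends[OF k \<eta>] by simp
  then show False using wall_ends[OF k \<eta>] by simp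
qed

section \<open>Randomness\<close>

text \<open>A case of the second Borel-Cantelli lemma: by independence, \<open>j + 1\<close>
  successive misses have probability at most \<open>(1 - p) ^ (j + 1)\<close>. The injection
  \<open>g\<close> selects a sequence from the joint family of sources.\<close>

lemma (in prob_space) AE_infinitely_often:
  assumes indep: "indep_vars (\<lambda>_. N) X I" and g: "inj g" "range g \<subseteq> I"
    and B: "B \<in> sets N" and p: "0 < p" "\<And>n. p \<le> prob (X (g n) -` B \<inter> space M)"
  shows "AE \<omega> in M. \<exists>\<^sub>\<infinity>n::nat. X (g n) \<omega> \<in> B"
proof -
  have meas: "X (g n) \<in> measurable M N" for n
    using indep g by (auto simp: indep_vars_def)
  let ?A = "\<lambda>n. X (g n) -` (space N - B) \<inter> space M"
  have A: "?A n \<in> events" for n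
    using B by (intro measurable_sets[OF meas]) auto
  have "?A n = space M - (X (g n) -` B \<inter> space M)" for n
    using measurable_space[OF meas] by auto
  then have pA: "prob (?A n) \<le> 1 - p" for n
    using p(2)[of n] measurable_sets[OF meas B] by (simp add: prob_compl)
  have "0 \<le> 1 - p"
    using pA[of 0] measure_nonneg[of M "?A 0"] by linarith
  have null: "AE \<omega> in M. \<exists>n>m. X (g n) \<omega> \<in> B" for m
  proof -
    let ?E = "\<Inter>n\<in>{m<..}. ?A n"
    have E: "?E \<in> events"
      using A by (intro sets.countable_INT') auto
    have le: "prob ?E \<le> (1 - p) ^ Suc j" for j
    proof -
      \<comment> \<open>\<open>Suc j\<close> keeps the index set nonempty, as the product rule for
        independent variables requires.\<close>
      let ?J = "{m<..m + Suc j}"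
      have "prob ?E \<le> prob (\<Inter>i\<in>g ` ?J. X i -` (space N - B) \<inter> space M)"
        using A by (intro finite_measure_mono sets.finite_INT) auto
      also have "\<dots> = (\<Prod>i\<in>g ` ?J. prob (X i -` (space N - B) \<inter> space M))"
        using g B by (intro indep_varsD[OF indep]) auto
      also have "\<dots> = (\<Prod>n\<in>?J. prob (?A n))"
        using g(1) by (subst prod.reindex) (auto simp: inj_on_def inj_def)
      also have "\<dots> \<le> (\<Prod>n\<in>?J. 1 - p)"
        by (intro prod_mono) (use pA in auto)
      finally show ?thesis by simp
    qed
    have "(\<lambda>j. (1 - p) ^ Suc j) \<longlonglongrightarrow> 0"
      using \<open>0 \<le> 1 - p\<close> p(1) by (intro LIMSEQ_Suc LIMSEQ_realpow_zero) auto
    then have "prob ?E \<le> 0"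
      by (rule LIMSEQ_le_const) (use le in auto)
    then have "prob ?E = 0"
      using measure_nonneg[of M ?E] by linarith
    then have "AE \<omega> in M. \<omega> \<notin> ?E"
      using E by (simp add: prob_eq_0)
    with AE_space show ?thesis
      by eventually_elim (use measurable_space[OF meas] in auto)
  qed
  then show ?thesis
    unfolding INFM_nat AE_all_countable by simp
qed

text \<open>Each of the infinitely many waits longer than 1 raises the ring time by more than 1, so
  the ring times pass every natural number.\<close>

lemma regular_clockI:
  assumes pos: "\<And>n. 0 < u n" and inf: "\<exists>\<^sub>\<infinity>n. 1 < u n"
  shows "regular_clock u"
proof -
  have unbounded: "\<exists>n. real j < ring_time u n" for j
  proof (induction j)
    case 0
    then show ?case using pos[of 0] by (auto simp: ring_time_def intro: exI[of _ 0])
  next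
    case (Suc j)
    then obtain n where n: "real j < ring_time u n" by auto
    obtain m where m: "n < m" "1 < u m" using inf by (auto simp: INFM_nat)
    have "ring_time u n + u m = sum u (insert m {..n})"
      using m by (simp add: ring_time_def)
    also have "\<dots> \<le> ring_time u m"
      unfolding ring_time_def using m pos by (intro sum_mono2) (auto simp: less_imp_le)
    finally show ?case using n m by (intro exI[of _ m]) simp
  qed
  show ?thesis
    unfolding regular_clock_def
  proof (intro conjI allI)
    fix t
    obtain j where "t \<le> real j" using real_arch_simple by blast
    then show "\<exists>n. t < ring_time u n" using unbounded[of j] by (meson le_less_trans)
  qed (rule pos)
qed

lemma countable_slab: "countable (slab k)"
  by (rule countable_subset[OF subset_UNIV]) simp

section \<open>Almost sure properties of clocks and coins, and the initial pattern\<close>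

context slab_glauber
begin

lemma AE_regular_clock:
  "AE \<omega> in M. \<forall>x\<in>slab k. regular_clock (\<lambda>n. W x n \<omega>)"
  unfolding AE_ball_countable[OF countable_slab]
proof
  fix x assume x: "x \<in> slab k"
  have gt: "prob {\<omega> \<in> space M. a < W x n \<omega>} = exp (- a)" if "0 \<le> a" for a n
    using exponential_distributedD_gt[OF waiting_time[OF x] that] by simp
  have meas: "W x n \<in> borel_measurable M" for n
    using distributed_measurable[OF waiting_time[OF x]] by simp
  have "{\<omega> \<in> space M. 0 < W x n \<omega>} \<in> events" for n
    using meas[of n] by measurable
  then have "AE \<omega> in M. 0 < W x n \<omega>" for n
    using gt[of 0 n] by (simp add: prob_Collect_eq_1)
  then have pos: "AE \<omega> in M. \<forall>n. 0 < W x n \<omega>"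
    by (simp add: AE_all_countable)
  have "AE \<omega> in M. \<exists>\<^sub>\<infinity>n. noise \<sigma> W C (Wait x n) \<omega> \<in> {1<..}"
  proof (rule AE_infinitely_often[OF independent])
    show "exp (- 1) \<le> prob (noise \<sigma> W C (Wait x n) -` {1<..} \<inter> space M)" for n
      using gt[of 1 n] by (simp add: vimage_def Int_def conj_commute)
  qed (use x in \<open>auto simp: inj_def sources_def\<close>)
  with pos show "AE \<omega> in M. regular_clock (\<lambda>n. W x n \<omega>)"
    by eventually_elim (auto intro: regular_clockI)
qed

lemma AE_coins:
  "AE \<omega> in M. \<forall>x\<in>slab k. \<forall>v\<in>{-1, 1}. \<exists>\<^sub>\<infinity>n. C x n \<omega> = v"
  unfolding AE_ball_countable[OF countable_slab]
proof
  fix x assume x: "x \<in> slab k"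
  have "AE \<omega> in M. \<exists>\<^sub>\<infinity>n. C x n \<omega> = v" if v: "v \<in> {-1, 1}" for v
  proof -
    have "AE \<omega> in M. \<exists>\<^sub>\<infinity>n. noise \<sigma> W C (Coin x n) \<omega> \<in> {of_int v}"
    proof (rule AE_infinitely_often[OF independent])
      show "1 / 2 \<le> prob (noise \<sigma> W C (Coin x n) -` {of_int v} \<inter> space M)" for n
        using coin[OF x, of n] v by (auto simp: vimage_def Int_def conj_commute)
    qed (use x in \<open>auto simp: inj_def sources_def\<close>)
    then show ?thesis by simp
  qed
  then show "AE \<omega> in M. \<forall>v\<in>{-1, 1}. \<exists>\<^sub>\<infinity>n. C x n \<omega> = v"
    by simp
qed

text \<open>By independence the pattern occurs initially with probability a power of 1/2. The
  negated form combines directly with other almost sure statements.\<close>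

lemma initial_pattern_pos:
  assumes fin: "finite {x. \<eta> x \<noteq> 0}" and sub: "{x. \<eta> x \<noteq> 0} \<subseteq> slab k"
    and val: "\<And>x. \<eta> x \<noteq> 0 \<Longrightarrow> \<eta> x \<in> {-1, 1}"
  shows "\<not> (AE \<omega> in M. \<exists>x. \<eta> x \<noteq> 0 \<and> \<sigma> 0 \<omega> x \<noteq> \<eta> x)"
proof (cases "{x. \<eta> x \<noteq> 0} = {}")
  \<comment> \<open>The empty pattern is separate because the product rule needs a nonempty index
    set.\<close>
  case True
  then show ?thesis using AE_False by auto
next
  case False
  let ?F = "{x. \<eta> x \<noteq> 0}"
  define A :: "source \<Rightarrow> real set" where "A i = (case i of Init x \<Rightarrow> {of_int (\<eta> x)} | _ \<Rightarrow> {})" for i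
  let ?E = "\<Inter>i\<in>Init ` ?F. noise \<sigma> W C i -` A i \<inter> space M"
  have A: "A i \<in> sets borel" for i by (cases i) (auto simp: A_def)
  have half: "prob (noise \<sigma> W C (Init x) -` A (Init x) \<inter> space M) = 1 / 2" if "x \<in> ?F" for x
    using initial_spin[of x] val[of x] sub that
    by (auto simp: A_def vimage_def Int_def conj_commute)
  have src: "Init ` ?F \<subseteq> sources k" using sub by (auto simp: sources_def)
  have "noise \<sigma> W C i \<in> borel_measurable M" if "i \<in> sources k" for i
    using independent that by (simp add: indep_vars_def)
  then have E: "?E \<in> events"
    using src fin False A by (intro sets.finite_INT measurable_sets[of _ M borel]) auto
  have "prob ?E = (\<Prod>i\<in>Init ` ?F. prob (noise \<sigma> W C i -` A i \<inter> space M))"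
    using src fin False A by (intro indep_varsD[OF independent]) auto
  also have "\<dots> = (\<Prod>x\<in>?F. prob (noise \<sigma> W C (Init x) -` A (Init x) \<inter> space M))"
    by (subst prod.reindex) (simp_all add: inj_on_def)
  also have "\<dots> = (\<Prod>x\<in>?F. 1 / 2)"
    by (rule prod.cong[OF refl half])
  finally have pos: "prob ?E > 0" by simp
  have imp: "\<omega> \<notin> ?E" if "\<exists>x. \<eta> x \<noteq> 0 \<and> \<sigma> 0 \<omega> x \<noteq> \<eta> x" for \<omega>
    using that by (auto simp: A_def)
  have "\<not> (AE \<omega> in M. \<omega> \<notin> ?E)"
    using pos prob_eq_0[OF E] by auto
  then show ?thesis
    by (rule contrapos_nn) (erule eventually_mono, rule imp)
qed

text \<open>Fixation would make the initial spins miss the pattern almost surely, because a site of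
  the row would otherwise keep flipping. But the pattern has positive probability.\<close>

lemma not_fixates:
  assumes k: "k \<ge> 3" "bc = Periodic \<Longrightarrow> k \<ge> 4"
  shows "\<not> fixates M k \<sigma>"
proof
  let ?\<eta> = "slab_pattern k"
  assume "fixates M k \<sigma>"
  then have conv: "AE \<omega> in M. \<forall>v\<in>slab k. \<exists>T\<ge>0. \<forall>t\<ge>T. \<sigma> t \<omega> v = \<sigma> T \<omega> v"
    by (simp add: fixates_def)
  have "AE \<omega> in M. \<exists>x. ?\<eta> x \<noteq> 0 \<and> \<sigma> 0 \<omega> x \<noteq> ?\<eta> x"
    using conv dynamics AE_regular_clock AE_coins
  proof eventually_elim
    case (elim \<omega>)
    let ?s = "\<lambda>t. \<sigma> t \<omega>"
    note traj = elim(2)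
    show ?case
    proof (rule ccontr)
      assume "\<not> ?case"
      then have init: "?s 0 y = ?\<eta> y" if "?\<eta> y \<noteq> 0" for y
        using that by blast
      have reg: "regular_clock (\<lambda>n. W x n \<omega>)" if "x \<in> slab k" for x
        using elim(3) that by blast
      have frozen: "?s t y = ?\<eta> y" if "?\<eta> y \<noteq> 0" "0 \<le> t" for t y
        by (rule stable_pattern_invariant[OF traj reg slab_pattern_support stable_slab_pattern[OF k] init that])
      have site: "(a, 5, 1) \<in> slab k" for a using k by (simp add: slab_def)
      have "\<exists>v. eventually (\<lambda>t. ?s t (a, 5, 1) = v) at_top" for a
      proof -
        obtain T where "\<forall>t\<ge>T. ?s t (a, 5, 1) = ?s T (a, 5, 1)"
          using elim(1) site[of a] by blast
        then show ?thesis
          unfolding eventually_at_top_linorder by blast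
      qed
      then have "\<forall>a. \<exists>v. eventually (\<lambda>t. ?s t (a, 5, 1) = v) at_top" by blast
      then obtain v where v: "eventually (\<lambda>t. ?s t (a, 5, 1) = v a) at_top" for a
        by (auto dest!: choice)
      \<comment> \<open>One time serves the row and its ends 2 and 7, whose spins enter the
        energies.\<close>
      have "eventually (\<lambda>t. 0 \<le> t \<and> (\<forall>a\<in>{2..7}. ?s t (a, 5, 1) = v a)) at_top"
        by (intro eventually_conj eventually_ge_at_top eventually_ball_finite ballI v) simp
      then obtain T where T: "t \<ge> T \<Longrightarrow> 0 \<le> t \<and> (\<forall>a\<in>{2..7}. ?s t (a, 5, 1) = v a)" for t
        unfolding eventually_at_top_linorder by blast
      have T0: "0 \<le> T" using T by blast
      obtain a where a: "a \<in> {3..6}" "energy bc k (?s T) (a, 5, 1) \<ge> 0"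
        using wall_unstable[OF k(1) trajectory_value[OF traj _ T0] frozen[OF _ T0]] by blast
      \<comment> \<open>From \<open>T\<close> on the energy depends only on spins that no longer
        change, so its sign at \<open>T\<close> persists.\<close>
      have E: "energy bc k (?s t) (a, 5, 1) = - v a * (v (a + 1) + v (a - 1))" if "t \<ge> T" for t
      proof -
        have t: "0 \<le> t" using T[OF that] by simp
        have "?s t (a + i, 5, 1) = v (a + i)" if "i \<in> {-1..1}" for i
          using T[OF \<open>t \<ge> T\<close>] a(1) that by auto
        from this[of "-1"] this[of 0] this[of 1] show ?thesis
          using wall_energy[OF k(1) frozen[OF _ t] a(1), of bc] by simp
      qed
      have "\<exists>t\<ge>T. ?s t (a, 5, 1) \<noteq> ?s T (a, 5, 1)"
      proof (rule not_eventually_constant[OF traj _ k(1) site T0])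
        show "0 \<le> energy bc k (?s t) (a, 5, 1)" if "T \<le> t" for t
          using E[OF that] E[of T] a(2) by simp
        show "\<exists>\<^sub>\<infinity>n. C (a, 5, 1) n \<omega> = u" if "u \<in> {-1, 1}" for u
          using elim(4) site that by blast
      qed (rule reg)
      moreover have "?s t (a, 5, 1) = v a" if "t \<ge> T" for t
        using T[OF that] a(1) by auto
      ultimately show False by auto
    qed
  qed
  then show False
    using initial_pattern_pos[OF slab_pattern_support slab_pattern_value] by blast
qed

end

theorem theorem2:
  fixes M :: "'a measure"
    and \<sigma> :: "real \<Rightarrow> 'a \<Rightarrow> config"
    and W :: "site \<Rightarrow> nat \<Rightarrow> 'a \<Rightarrow> real"
    and C :: "site \<Rightarrow> nat \<Rightarrow> 'a \<Rightarrow> int"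
  shows "(\<forall>k\<ge>4. slab_glauber M Periodic k \<sigma> W C \<longrightarrow> \<not> fixates M k \<sigma>) \<and>
         (\<forall>k\<ge>3. slab_glauber M Free k \<sigma> W C \<longrightarrow> \<not> fixates M k \<sigma>)"
  by (auto dest: slab_glauber.not_fixates)

end
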